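(* Let $S$ and $V$ be non-empty sets with $S\subseteq V$, let $(\Omega,\mathcal F,\mathbb P)$ be a probability space, let $(\mathfrak R,\mathcal R)$ be a measurable space, let $R\colon\Omega\to\mathfrak R$ be a random variable, let $N\in\mathbb N$, for every $v\in V$ let $U_v\colon\mathfrak R\to\mathbb R^N$ be measurable, assume for all $v\in V$ that $\mathbb P(U_v(R)=0)=1$ if and only if $v\in S$, and let $\ell\colon V\to[0,\infty]$ satisfy for all $v\in V$ that $\ell(v)=\mathbb E[\|U_v(R)\|^2]$. Then (i) for all $v\in V$ it holds that $\ell(v)=\inf_{w\in V}\ell(w)$ if and only if $v\in S$, and (ii) there exists $v\in V$ such that $\ell(v)=\inf_{w\in V}\ell(w)$.
   Context: $\mathbb N=\{1,2,3,\dots\}$. $\|\cdot\|$ is the Euclidean norm on $\mathbb R^N$. Random variables are measurable functions; $\mathbb R^N$ carries its Borel sigma-algebra. *)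

theory Defs
  imports "HOL-Probability.Probability"
begin

end

theory Submission
  imports Defs
begin

text \<open>The loss is the expectation of a nonnegative function, so by
  \<open>nn_integral_norm_power2_eq_0_iff\<close> it vanishes exactly where
  \<open>U v (R \<omega>)\<close> is almost surely zero, that is, exactly for \<open>v\<close> in
  \<open>S\<close>. Since \<open>S\<close> is nonempty, the lower bound 0 is attained. Hence the
  infimum is 0 and the minimizers are the zeros of \<open>l\<close>.\<close>

lemma (in prob_space) nn_integral_norm_power2_eq_0_iff:
  fixes X :: "'a \<Rightarrow> 'b::{real_normed_vector, second_countable_topology}"
  assumes "X \<in> borel_measurable M"
  shows "(\<integral>\<^sup>+ \<omega>. ennreal ((norm (X \<omega>))\<^sup>2) \<partial>M) = 0 \<longleftrightarrow> \<P>(\<omega> in M. X \<omega> = 0) = 1"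
proof -
  note [measurable] = assms
  \<comment> \<open>\<open>ennreal\<close> truncates negative reals to 0, so the integrand vanishes
    where the squared norm is at most 0, which means \<open>X \<omega> = 0\<close>.\<close>
  have "(\<integral>\<^sup>+ \<omega>. ennreal ((norm (X \<omega>))\<^sup>2) \<partial>M) = 0 \<longleftrightarrow> (AE \<omega> in M. X \<omega> = 0)"
    by (subst nn_integral_0_iff_AE) (auto simp: ennreal_eq_0_iff)
  \<comment> \<open>Measurability of \<open>X\<close> makes the zero set an event, so holding almost
    surely amounts to having probability 1.\<close>
  also have "\<dots> \<longleftrightarrow> \<P>(\<omega> in M. X \<omega> = 0) = 1"
    by (rule prob_Collect_eq_1[symmetric]) measurable
  finally show ?thesis .
qed

theorem corollary2p2:
  fixes S V :: "'v set"
    and M :: "'w measure"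
    and K :: "'r measure"
    and R :: "'w \<Rightarrow> 'r"
    and U :: "'v \<Rightarrow> 'r \<Rightarrow> real ^ 'n"
    and l :: "'v \<Rightarrow> ennreal"
  assumes "S \<noteq> {}" and "V \<noteq> {}" and "S \<subseteq> V"
    and "prob_space M"
    and "R \<in> M \<rightarrow>\<^sub>M K"
    and "\<And>v. v \<in> V \<Longrightarrow> U v \<in> K \<rightarrow>\<^sub>M borel"
    and "\<And>v. v \<in> V \<Longrightarrow> \<P>(\<omega> in M. U v (R \<omega>) = 0) = 1 \<longleftrightarrow> v \<in> S"
    and "\<And>v. v \<in> V \<Longrightarrow> l v = (\<integral>\<^sup>+ \<omega>. ennreal ((norm (U v (R \<omega>)))\<^sup>2) \<partial>M)"
  shows "(\<forall>v\<in>V. l v = (INF w\<in>V. l w) \<longleftrightarrow> v \<in> S) \<and> (\<exists>v\<in>V. l v = (INF w\<in>V. l w))"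
proof -
  interpret prob_space M by fact
  have zero_iff: "l v = 0 \<longleftrightarrow> v \<in> S" if "v \<in> V" for v
  proof -
    have "(\<lambda>\<omega>. U v (R \<omega>)) \<in> borel_measurable M"
      using measurable_compose[OF assms(5) assms(6)[OF that]] .
    from nn_integral_norm_power2_eq_0_iff[OF this] show ?thesis
      using assms(7,8)[OF that] by simp
  qed
  obtain s where s: "s \<in> S" "s \<in> V"
    using assms(1,3) by blast
  \<comment> \<open>Any element of \<open>S\<close> has loss 0 and so bounds the infimum from above;
    0 is the least element of \<open>ennreal\<close>.\<close>
  then have "(INF w\<in>V. l w) \<le> 0"
    by (metis INF_lower zero_iff)
  then have "(INF w\<in>V. l w) = 0"
    by simp
  then show ?thesis
    \<comment> \<open>Being a minimizer now means having loss 0, and \<open>s\<close> witnesses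
      existence.\<close>
    using zero_iff s by auto
qed

end
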